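(* Let $G$ be a finitely generated group and $H$ a subgroup of $G$ with $[G:H]<\infty$. If $K$ is a subgroup of $H$, then $(G,K)$ is context-free if and only if $(H,K)$ is context-free.
   Context: A *semigroup presentation* of a finitely generated group $G$ is a (not necessarily injective) map $\psi:\Sigma\to G$ from a finite alphabet $\Sigma$ such that its extension to a monoid homomorphism $\psi:\Sigma^*\to G$ is surjective. For a subgroup $K\le G$ (not necessarily finitely generated), $L(G,K,\psi)=\{w\in\Sigma^*:\psi(w)\in K\}$. The pair $(G,K)$ is *context-free* if $L(G,K,\psi)$ is a context-free language for some (equivalently, every) semigroup presentation $\psi$ of $G$. *)

theory Defs
  imports "HOL-Algebra.Coset" "HOL-Algebra.Generated_Groups"
begin

subsection \<open>Context-free languages\<close>

datatype ('n, 't) sym = Nt 'n | Tm 't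

type_synonym ('n, 't) prods = "('n \<times> ('n, 't) sym list) set"

definition cf_grammar :: "'n set \<Rightarrow> 't set \<Rightarrow> ('n, 't) prods \<Rightarrow> 'n \<Rightarrow> bool" where
  "cf_grammar N \<Sigma> P S \<longleftrightarrow>
     finite N \<and> finite \<Sigma> \<and> S \<in> N \<and> finite P \<and> P \<subseteq> N \<times> lists (Nt ` N \<union> Tm ` \<Sigma>)"

inductive derive_step :: "('n, 't) prods \<Rightarrow> ('n, 't) sym list \<Rightarrow> ('n, 't) sym list \<Rightarrow> bool"
  for P where
  "(A, \<alpha>) \<in> P \<Longrightarrow> derive_step P (u @ [Nt A] @ v) (u @ \<alpha> @ v)"

definition grammar_language :: "('n, 't) prods \<Rightarrow> 'n \<Rightarrow> 't list set" where
  "grammar_language P S = {w. (derive_step P)\<^sup>*\<^sup>* [Nt S] (map Tm w)}"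

text \<open>
  A grammar has only finitely many nonterminals and these may be renamed, so
  drawing them from \<^typ>\<open>nat\<close> is no restriction.
\<close>
definition context_free_language :: "'t set \<Rightarrow> 't list set \<Rightarrow> bool" where
  "context_free_language \<Sigma> L \<longleftrightarrow>
     (\<exists>(N :: nat set) P S. cf_grammar N \<Sigma> P S \<and> L = grammar_language P S)"

subsection \<open>Semigroup presentations and context-free pairs\<close>

definition finitely_generated :: "('a, 'm) monoid_scheme \<Rightarrow> bool" where
  "finitely_generated G \<longleftrightarrow> (\<exists>A. finite A \<and> A \<subseteq> carrier G \<and> generate G A = carrier G)"

definition word_value :: "('a, 'm) monoid_scheme \<Rightarrow> ('s \<Rightarrow> 'a) \<Rightarrow> 's list \<Rightarrow> 'a" where
  "word_value G \<psi> w = foldr (\<otimes>\<^bsub>G\<^esub>) (map \<psi> w) \<one>\<^bsub>G\<^esub>"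

text \<open>Surjectivity is that of a monoid homomorphism: inverses of letters are not available.\<close>
definition semigroup_presentation ::
  "('a, 'm) monoid_scheme \<Rightarrow> 's set \<Rightarrow> ('s \<Rightarrow> 'a) \<Rightarrow> bool" where
  "semigroup_presentation G \<Sigma> \<psi> \<longleftrightarrow>
     finite \<Sigma> \<and> \<psi> \<in> \<Sigma> \<rightarrow> carrier G \<and> word_value G \<psi> ` lists \<Sigma> = carrier G"

definition pair_language ::
  "('a, 'm) monoid_scheme \<Rightarrow> 'a set \<Rightarrow> 's set \<Rightarrow> ('s \<Rightarrow> 'a) \<Rightarrow> 's list set" where
  "pair_language G K \<Sigma> \<psi> = {w \<in> lists \<Sigma>. word_value G \<psi> w \<in> K}"

text \<open>
  HOL cannot quantify over the type of letters inside a definition. Every finite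
  alphabet is in bijection with a finite set of natural numbers, so alphabets
  are taken to be finite subsets of \<^typ>\<open>nat\<close>.
\<close>
definition context_free_pair :: "('a, 'm) monoid_scheme \<Rightarrow> 'a set \<Rightarrow> bool" where
  "context_free_pair G K \<longleftrightarrow>
     (\<exists>(\<Sigma> :: nat set) \<psi>. semigroup_presentation G \<Sigma> \<psi> \<and>
        context_free_language \<Sigma> (pair_language G K \<Sigma> \<psi>))"

end

theory Submission
  imports Defs "HOL-Library.Sublist"
begin

text \<open>
  Both directions rewrite words over one presentation into words over another by a
  deterministic sequential machine, and context-free languages are closed under preimages of
  such machines. Passing from \<open>G\<close> to \<open>H\<close> the machine is a monoid homomorphism. Passing from
  \<open>H\<close> to \<open>G\<close> its states are the finitely many right cosets of \<open>H\<close>: in state \<open>C\<close> it replaces a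
  letter \<open>a\<close> by a word for the Schreier element \<open>rep C \<cdot> a \<cdot> (rep (C a))\<^sup>-\<^sup>1\<close> of \<open>H\<close>, so a word that
  returns to the coset \<open>H\<close> is rewritten into a word over \<open>H\<close> with the same value. The same
  elements generate \<open>H\<close> as a monoid.
\<close>

section \<open>Derivations\<close>

text \<open>Big-step form of derivation: a proof of \<open>yields\<close> is a parse forest, so
  inductions follow the grammar rather than the order of rewriting steps.\<close>

inductive yields :: "('n, 't) prods \<Rightarrow> ('n, 't) sym list \<Rightarrow> 't list \<Rightarrow> bool"
  for P where
  Nil: "yields P [] []"
| Tm: "yields P \<beta> w \<Longrightarrow> yields P (Tm t # \<beta>) (t # w)"
| Nt: "(A, \<alpha>) \<in> P \<Longrightarrow> yields P \<alpha> u \<Longrightarrow> yields P \<beta> v \<Longrightarrow> yields P (Nt A # \<beta>) (u @ v)"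

lemma yields_append:
  "yields P \<alpha> u \<Longrightarrow> yields P \<beta> v \<Longrightarrow> yields P (\<alpha> @ \<beta>) (u @ v)"
  by (induction rule: yields.induct) (auto intro: yields.intros)

text \<open>The symbols of a form are expanded independently of each other, so a cut of the form
  induces a cut of the word. The induction moves the cut into the tail of the form.\<close>

lemma yields_appendE:
  assumes "yields P (\<alpha> @ \<beta>) w"
  obtains u v where "w = u @ v" "yields P \<alpha> u" "yields P \<beta> v"
proof -
  have "\<exists>u v. w = u @ v \<and> yields P \<alpha> u \<and> yields P \<beta> v"
    using assms
  proof (induction "\<alpha> @ \<beta>" w arbitrary: \<alpha> rule: yields.induct)
    case Nil
    then show ?case by (auto intro: yields.intros)
  next
    case (Tm \<gamma> w t)
    show ?case
    proof (cases \<alpha>)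
      case Nil
      with Tm show ?thesis by (metis append_Nil yields.Nil yields.Tm)
    next
      case (Cons X \<alpha>')
      with Tm obtain u v where "w = u @ v" "yields P \<alpha>' u" "yields P \<beta> v" by auto
      with Cons Tm show ?thesis
        by (metis append_Cons list.inject yields.Tm)
    qed
  next
    case (Nt A \<delta> u \<gamma> v)
    show ?case
    proof (cases \<alpha>)
      case Nil
      with Nt show ?thesis by (metis append_Nil yields.Nil yields.Nt)
    next
      case (Cons X \<alpha>')
      with Nt obtain u' v' where "v = u' @ v'" "yields P \<alpha>' u'" "yields P \<beta> v'" by auto
      with Cons Nt show ?thesis
        by (metis append_Cons append_assoc list.inject yields.Nt)
    qed
  qed
  with that show thesis by blast
qed

lemma yields_map_Tm: "yields P (map Tm w) w"
  by (induction w) (auto intro: yields.intros)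

lemma yields_NtI: "(A, \<alpha>) \<in> P \<Longrightarrow> yields P \<alpha> w \<Longrightarrow> yields P [Nt A] w"
  by (metis append_Nil2 yields.Nil yields.Nt)

lemma derive_step_context:
  "derive_step P \<alpha> \<beta> \<Longrightarrow> derive_step P (u @ \<alpha> @ v) (u @ \<beta> @ v)"
  by (elim derive_step.cases) (metis append.assoc derive_step.intros)

lemma derives_context:
  "(derive_step P)\<^sup>*\<^sup>* \<alpha> \<beta> \<Longrightarrow> (derive_step P)\<^sup>*\<^sup>* (u @ \<alpha> @ v) (u @ \<beta> @ v)"
  by (induction rule: rtranclp_induct) (auto intro: rtranclp.rtrancl_into_rtrancl derive_step_context)

lemma yields_imp_derives: "yields P \<alpha> w \<Longrightarrow> (derive_step P)\<^sup>*\<^sup>* \<alpha> (map Tm w)"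
proof (induction rule: yields.induct)
  case (Tm \<beta> w t)
  then show ?case using derives_context[of P \<beta> "map Tm w" "[Tm t]" "[]"] by simp
next
  case (Nt A \<alpha> u \<beta> v)
  have "derive_step P (Nt A # \<beta>) (\<alpha> @ \<beta>)"
    using derive_step.intros[OF Nt.hyps(1), of "[]" \<beta>] by simp
  also have "(derive_step P)\<^sup>*\<^sup>* (\<alpha> @ \<beta>) (map Tm u @ \<beta>)"
    using derives_context[OF Nt.IH(1), of "[]" \<beta>] by simp
  also have "(derive_step P)\<^sup>*\<^sup>* (map Tm u @ \<beta>) (map Tm u @ map Tm v)"
    using derives_context[OF Nt.IH(2), of "map Tm u" "[]"] by simp
  finally show ?case by simp
qed simp

text \<open>Cutting the form around the rewritten block isolates the forest of
  \<open>\<alpha>\<close>, which is then hung below a root \<open>A\<close>. Applied backwards from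
  a terminal word, this turns any derivation into a forest.\<close>

lemma derive_step_yields:
  assumes "derive_step P \<alpha> \<beta>" "yields P \<beta> w"
  shows "yields P \<alpha> w"
  using assms
proof (induction rule: derive_step.induct)
  case (1 A \<alpha> u v)
  then show ?case
    by (metis yields_NtI yields_append yields_appendE)
qed

lemma derives_imp_yields: "(derive_step P)\<^sup>*\<^sup>* \<alpha> (map Tm w) \<Longrightarrow> yields P \<alpha> w"
  by (induction rule: converse_rtranclp_induct) (auto intro: derive_step_yields yields_map_Tm)

lemma grammar_language_yields: "grammar_language P S = {w. yields P [Nt S] w}"
  unfolding grammar_language_def by (blast intro: yields_imp_derives derives_imp_yields)

text \<open>
  \<open>sentential I \<alpha> w\<close> evaluates a sentential form under an assignment \<open>I\<close> of languages to
  nonterminals. Soundness arguments then amount to exhibiting a pre-fixed point of the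
  grammar's system of equations, of which the derived languages are the least solution.
\<close>
fun sentential :: "('n \<Rightarrow> 't list \<Rightarrow> bool) \<Rightarrow> ('n, 't) sym list \<Rightarrow> 't list \<Rightarrow> bool" where
  "sentential I [] w \<longleftrightarrow> w = []"
| "sentential I (Tm t # \<beta>) w \<longleftrightarrow> (\<exists>v. w = t # v \<and> sentential I \<beta> v)"
| "sentential I (Nt A # \<beta>) w \<longleftrightarrow> (\<exists>u v. w = u @ v \<and> I A u \<and> sentential I \<beta> v)"

lemma sentential_Tm_append:
  "sentential I (map Tm u @ \<beta>) w \<longleftrightarrow> (\<exists>v. w = u @ v \<and> sentential I \<beta> v)"
  by (induction u arbitrary: w) auto

lemma yields_sentential:
  assumes "yields P \<alpha> w"
    and "\<And>A \<alpha> w. (A, \<alpha>) \<in> P \<Longrightarrow> sentential I \<alpha> w \<Longrightarrow> I A w"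
  shows "sentential I \<alpha> w"
  using assms(1) by induction (auto intro: assms(2))

section \<open>Renaming nonterminals\<close>

definition rename_prods :: "('n \<Rightarrow> 'm) \<Rightarrow> ('n, 't) prods \<Rightarrow> ('m, 't) prods" where
  "rename_prods f P = map_prod f (map (map_sym f (\<lambda>t. t))) ` P"

lemma yields_rename:
  "yields P \<alpha> w \<Longrightarrow> yields (rename_prods f P) (map (map_sym f (\<lambda>t. t)) \<alpha>) w"
proof (induction rule: yields.induct)
  case (Nt A \<alpha> u \<beta> v)
  then have "(f A, map (map_sym f (\<lambda>t. t)) \<alpha>) \<in> rename_prods f P"
    by (force simp: rename_prods_def)
  with Nt.IH show ?case by (auto intro: yields.intros)
qed (auto intro: yields.intros)

text \<open>The grammars built below have tuples as nonterminals, whereas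
  \<open>context_free_language\<close> asks for natural numbers. A finite set of nonterminals embeds
  into \<open>nat\<close>, and the grammar is renamed along the embedding.\<close>

lemma context_free_languageI:
  fixes P :: "('n, 't) prods"
  assumes "cf_grammar N \<Sigma> P S"
  shows "context_free_language \<Sigma> (grammar_language P S)"
proof -
  note G = assms[unfolded cf_grammar_def]
  obtain f :: "'n \<Rightarrow> nat" where f: "inj_on f N"
    using G finite_imp_inj_to_nat_seg[of N] by auto
  define g where "g = inv_into N f"
  have gf: "g (f A) = A" if "A \<in> N" for A
    using that f by (simp add: g_def)
  have sym: "map_sym g (\<lambda>t. t) (map_sym f (\<lambda>t. t) X) = X" if "X \<in> Nt ` N \<union> Tm ` \<Sigma>" for X :: "('n, 't) sym"
    using that gf by auto
  have "map (map_sym g (\<lambda>t. t)) (map (map_sym f (\<lambda>t. t)) \<alpha>) = \<alpha>" if "(A, \<alpha>) \<in> P" for A \<alpha>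
  proof -
    from that G have "\<alpha> \<in> lists (Nt ` N \<union> Tm ` \<Sigma>)" by blast
    then show ?thesis by (induction \<alpha>) (use sym in auto)
  qed
  moreover have "g (f A) = A" if "(A, \<alpha>) \<in> P" for A \<alpha>
    using that G gf by blast
  ultimately have "map_prod g (map (map_sym g (\<lambda>t. t))) (map_prod f (map (map_sym f (\<lambda>t. t))) x) = x"
    if "x \<in> P" for x
    using that by (cases x) (simp del: map_map)
  then have inverse: "rename_prods g (rename_prods f P) = P"
    unfolding rename_prods_def image_image by simp
  \<comment> \<open>Renaming preserves derivations along any map, so the converse direction follows
    by renaming back along \<open>g\<close>.\<close>
  have "yields P [Nt S] w \<longleftrightarrow> yields (rename_prods f P) [Nt (f S)] w" for w
    using yields_rename[of P "[Nt S]" w f] yields_rename[of "rename_prods f P" "[Nt (f S)]" w g]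
    by (auto simp: inverse gf G)
  then have "grammar_language P S = grammar_language (rename_prods f P) (f S)"
    by (simp add: grammar_language_yields)
  moreover have "cf_grammar (f ` N) \<Sigma> (rename_prods f P) (f S)"
  proof -
    have "map (map_sym f (\<lambda>t. t)) \<alpha> \<in> lists (Nt ` f ` N \<union> Tm ` \<Sigma>)"
      if "\<alpha> \<in> lists (Nt ` N \<union> Tm ` \<Sigma>)" for \<alpha> :: "('n, 't) sym list"
      using that by (induction \<alpha>) auto
    with G show ?thesis
      unfolding cf_grammar_def rename_prods_def by fast
  qed
  ultimately show ?thesis
    unfolding context_free_language_def by blast
qed

section \<open>Images under finite transducers\<close>

text \<open>Transitions carry words on both tapes, so that a step may read without writing or write
  without reading. Both end states are explicit, which allows runs to be cut and composed.\<close>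

inductive run :: "('q \<times> 't list \<times> 's list \<times> 'q) set \<Rightarrow> 'q \<Rightarrow> 't list \<Rightarrow> 's list \<Rightarrow> 'q \<Rightarrow> bool"
  for \<Delta> where
  stop: "run \<Delta> p [] [] p"
| step: "(p, u, v, p') \<in> \<Delta> \<Longrightarrow> run \<Delta> p' w x q \<Longrightarrow> run \<Delta> p (u @ w) (v @ x) q"

locale transducer =
  fixes Q :: "'q set" and \<Sigma> :: "'s set" and \<Delta> :: "('q \<times> 't list \<times> 's list \<times> 'q) set"
  assumes finite_states: "finite Q" and finite_output: "finite \<Sigma>" and finite_trans: "finite \<Delta>"
    and trans: "(p, u, v, q) \<in> \<Delta> \<Longrightarrow> p \<in> Q \<and> length u \<le> 1 \<and> v \<in> lists \<Sigma> \<and> q \<in> Q"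
begin

text \<open>A transition reads at most one letter, hence none straddles the border between
  \<open>u\<close> and \<open>v\<close>.\<close>

lemma run_appendE:
  assumes "run \<Delta> p (u @ v) x q" "p \<in> Q"
  obtains y z r where "x = y @ z" "run \<Delta> p u y r" "run \<Delta> r v z q" "r \<in> Q"
proof -
  have "\<exists>y z r. x = y @ z \<and> run \<Delta> p u y r \<and> run \<Delta> r v z q \<and> r \<in> Q"
    using assms
  proof (induction p "u @ v" x q arbitrary: u rule: run.induct)
    case (stop p)
    then show ?case by (auto intro: run.intros)
  next
    case (step p a b p' w x q)
    show ?case
    proof (cases "u = []")
      case True
      with step show ?thesis by (metis append_Nil run.stop run.step)
    next
      case False
      have "length a \<le> 1" using trans step.hyps(1) by blast
      with False step.hyps(4) obtain u' where u: "u = a @ u'" "w = u' @ v"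
        by (cases a; cases u) auto
      with step trans obtain y z r where
        "x = y @ z" "run \<Delta> p' u' y r" "run \<Delta> r v z q" "r \<in> Q" by metis
      with step.hyps(1) u show ?thesis by (metis append_assoc run.step)
    qed
  qed
  with that show thesis by blast
qed

text \<open>
  The nonterminal \<open>(p, \<alpha>, q)\<close> is meant to derive all outputs of runs from \<open>p\<close> to \<open>q\<close> on a
  word derived from \<open>\<alpha>\<close>.
\<close>
inductive_set trans_prods ::
    "('n, 't) prods \<Rightarrow> ('n, 't) sym list set \<Rightarrow> ('q \<times> ('n, 't) sym list \<times> 'q, 's) prods"
  for P \<Lambda> where
  stop: "q \<in> Q \<Longrightarrow> [] \<in> \<Lambda> \<Longrightarrow> ((q, [], q), []) \<in> trans_prods P \<Lambda>"
| read: "(p, u, v, p') \<in> \<Delta> \<Longrightarrow> map Tm u @ \<beta> \<in> \<Lambda> \<Longrightarrow> \<beta> \<in> \<Lambda> \<Longrightarrow> q \<in> Q \<Longrightarrow>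
    ((p, map Tm u @ \<beta>, q), map Tm v @ [Nt (p', \<beta>, q)]) \<in> trans_prods P \<Lambda>"
| expand: "(A, \<alpha>) \<in> P \<Longrightarrow> Nt A # \<beta> \<in> \<Lambda> \<Longrightarrow> \<alpha> \<in> \<Lambda> \<Longrightarrow> \<beta> \<in> \<Lambda> \<Longrightarrow> p \<in> Q \<Longrightarrow> r \<in> Q \<Longrightarrow> q \<in> Q \<Longrightarrow>
    ((p, Nt A # \<beta>, q), [Nt (p, \<alpha>, r), Nt (r, \<beta>, q)]) \<in> trans_prods P \<Lambda>"

lemma finite_trans_prods:
  assumes "finite P" "finite \<Lambda>"
  shows "finite (trans_prods P \<Lambda>)"
proof (rule finite_subset)
  show "trans_prods P \<Lambda> \<subseteq>
      (\<lambda>q. ((q, [], q), [])) ` Q \<union>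
      (\<lambda>((p, u, v, p'), \<beta>, q). ((p, map Tm u @ \<beta>, q), map Tm v @ [Nt (p', \<beta>, q)])) ` (\<Delta> \<times> \<Lambda> \<times> Q) \<union>
      (\<lambda>((A, \<alpha>), \<beta>, p, r, q). ((p, Nt A # \<beta>, q), [Nt (p, \<alpha>, r), Nt (r, \<beta>, q)]))
        ` (P \<times> \<Lambda> \<times> Q \<times> Q \<times> Q)"
    by (auto elim!: trans_prods.cases simp: image_iff split: prod.splits) force+
qed (use assms finite_states finite_trans in auto)

lemma trans_prods_subset:
  "trans_prods P \<Lambda> \<subseteq> (Q \<times> \<Lambda> \<times> Q) \<times> lists (Nt ` (Q \<times> \<Lambda> \<times> Q) \<union> Tm ` \<Sigma>)"
proof (rule subrelI)
  have "((p, \<alpha>, q), \<gamma>) \<in> (Q \<times> \<Lambda> \<times> Q) \<times> lists (Nt ` (Q \<times> \<Lambda> \<times> Q) \<union> Tm ` \<Sigma>)"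
    if "((p, \<alpha>, q), \<gamma>) \<in> trans_prods P \<Lambda>" for p \<alpha> q \<gamma>
    using that
  proof cases
    case (read u v p' \<beta>)
    with trans[OF read(3)] show ?thesis by auto
  qed auto
  then show "(A, \<gamma>) \<in> (Q \<times> \<Lambda> \<times> Q) \<times> lists (Nt ` (Q \<times> \<Lambda> \<times> Q) \<union> Tm ` \<Sigma>)"
    if "(A, \<gamma>) \<in> trans_prods P \<Lambda>" for A \<gamma>
    using that by (cases A) blast
qed

text \<open>The intended languages, collected in \<open>?I\<close>, are closed under all three kinds
  of production, so they contain everything that is derived.\<close>

lemma trans_prods_sound:
  assumes "yields (trans_prods P \<Lambda>) [Nt (p, \<alpha>, q)] x"
  shows "\<exists>w. yields P \<alpha> w \<and> run \<Delta> p w x q"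
proof -
  let ?I = "\<lambda>(p, \<alpha>, q) x. \<exists>w. yields P \<alpha> w \<and> run \<Delta> p w x q"
  have run_trans: "run \<Delta> p w x r \<Longrightarrow> run \<Delta> r w' x' q \<Longrightarrow> run \<Delta> p (w @ w') (x @ x') q"
    for p w x r w' x' q
    by (induction rule: run.induct) (auto intro: run.intros)
  have "\<exists>w. yields P \<alpha> w \<and> run \<Delta> p w x q"
    if "((p, \<alpha>, q), \<gamma>) \<in> trans_prods P \<Lambda>" and x: "sentential ?I \<gamma> x" for p \<alpha> q \<gamma> x
    using that(1)
  proof cases
    case stop
    with x show ?thesis by (auto intro: run.intros yields.intros)
  next
    case (read u v p' \<beta>)
    with x obtain y w where "x = v @ y" "yields P \<beta> w" "run \<Delta> p' w y q"
      by (auto simp: sentential_Tm_append)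
    with read show ?thesis
      by (auto intro!: exI[of _ "u @ w"] run.step yields_append yields_map_Tm)
  next
    case (expand A \<delta> \<beta> r)
    with x obtain y z w w' where "x = y @ z" "yields P \<delta> w" "run \<Delta> p w y r"
      "yields P \<beta> w'" "run \<Delta> r w' z q"
      by auto
    with expand show ?thesis
      by (auto intro!: exI[of _ "w @ w'"] run_trans yields.Nt)
  qed
  then have "?I A x" if "(A, \<gamma>) \<in> trans_prods P \<Lambda>" "sentential ?I \<gamma> x" for A \<gamma> x
    using that by (cases A) blast
  then have "sentential ?I [Nt (p, \<alpha>, q)] x"
    using yields_sentential[OF assms, of ?I] by blast
  then show ?thesis by simp
qed

text \<open>Induction on the forest; at a nonterminal the run is cut where the subtree ends, and the
  state reached there is the guess \<open>r\<close>. The two closure conditions on \<Lambda> keep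
  every form that arises inside \<Lambda>.\<close>

lemma trans_prods_complete:
  assumes "yields P \<alpha> w" "run \<Delta> p w x q" "\<alpha> \<in> \<Lambda>" "p \<in> Q" "q \<in> Q"
    and tails: "\<And>X \<beta>. X # \<beta> \<in> \<Lambda> \<Longrightarrow> \<beta> \<in> \<Lambda>"
    and rhs: "\<And>A \<alpha>. (A, \<alpha>) \<in> P \<Longrightarrow> \<alpha> \<in> \<Lambda>"
  shows "yields (trans_prods P \<Lambda>) [Nt (p, \<alpha>, q)] x"
  using assms(1-5)
proof (induction arbitrary: p x q rule: yields.induct)
  case Nil
  \<comment> \<open>Transitions that read nothing may still fire on the empty word, whence the inner
    induction on the run.\<close>
  from Nil.prems(1) show ?case using Nil.prems(2-)
  proof (induction p "[] :: 't list" x q rule: run.induct)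
    case (stop p)
    then show ?case by (auto intro!: yields_NtI[OF trans_prods.stop] yields.Nil)
  next
    case (step p u v p' w x q)
    then have "yields (trans_prods P \<Lambda>) [Nt (p', [], q)] x" using trans by blast
    with step show ?case
      using trans_prods.read[of p u v p' "[]" \<Lambda> q P]
      by (auto intro!: yields_NtI yields_append yields_map_Tm)
  qed
next
  case (Tm \<beta> w t)
  \<comment> \<open>Again an inner induction on the run: transitions that read nothing may precede
    the one that reads \<open>t\<close>.\<close>
  from Tm.prems(1) show ?case using Tm.prems(2-)
  proof (induction p "t # w" x q rule: run.induct)
    case (step p u v p' w' x q)
    have \<beta>: "\<beta> \<in> \<Lambda>" using tails step.prems(1) by blast
    have p': "p' \<in> Q" using trans step.hyps(1) by blast
    have "length u \<le> 1" using trans step.hyps(1) by blast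
    then consider "u = []" "w' = t # w" | "u = [t]" "w' = w"
      using step.hyps(4) by (cases u) auto
    then show ?case
    proof cases
      case 1
      with step p' have "yields (trans_prods P \<Lambda>) [Nt (p', Tm t # \<beta>, q)] x" by blast
      with 1 step show ?thesis
        using trans_prods.read[of p u v p' "Tm t # \<beta>" \<Lambda> q P]
        by (auto intro!: yields_NtI yields_append yields_map_Tm)
    next
      case 2
      with step p' \<beta> Tm.IH have "yields (trans_prods P \<Lambda>) [Nt (p', \<beta>, q)] x" by blast
      with 2 step \<beta> show ?thesis
        using trans_prods.read[of p u v p' \<beta> \<Lambda> q P]
        by (auto intro!: yields_NtI yields_append yields_map_Tm)
    qed
  qed
next
  case (Nt A \<alpha> u \<beta> v)
  from Nt.prems obtain y z r where x: "x = y @ z" "run \<Delta> p u y r" "run \<Delta> r v z q" "r \<in> Q"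
    by (blast elim: run_appendE)
  have mem: "\<alpha> \<in> \<Lambda>" "\<beta> \<in> \<Lambda>" using tails rhs Nt by blast+
  have "yields (trans_prods P \<Lambda>) ([Nt (p, \<alpha>, r)] @ [Nt (r, \<beta>, q)]) (y @ z)"
    using Nt x mem by (intro yields_append) auto
  moreover have "((p, Nt A # \<beta>, q), [Nt (p, \<alpha>, r)] @ [Nt (r, \<beta>, q)]) \<in> trans_prods P \<Lambda>"
    using trans_prods.expand[of A \<alpha> P \<beta> \<Lambda> p r q] Nt x mem by simp
  ultimately show ?case
    using x by (auto intro: yields_NtI)
qed

text \<open>A triple construction in the style of Bar-Hillel: productions guess the states at which
  the run passes from one symbol to the next.\<close>

theorem context_free_image:
  assumes "context_free_language \<Gamma> L" "p \<in> Q" "q \<in> Q"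
  shows "context_free_language \<Sigma> {x. \<exists>w\<in>L. run \<Delta> p w x q}"
proof -
  obtain N :: "nat set" and P S where G: "cf_grammar N \<Gamma> P S" and L: "L = grammar_language P S"
    using assms(1) unfolding context_free_language_def by blast
  \<comment> \<open>The least set that contains the start form and all right-hand sides and is
    closed under tails; it is finite because \<open>P\<close> is.\<close>
  define \<Lambda> where "\<Lambda> = (\<Union>\<alpha>\<in>insert [Nt S] (snd ` P). set (suffixes \<alpha>))"
  have fin: "finite P" "finite \<Lambda>"
    using G by (auto simp: cf_grammar_def \<Lambda>_def)
  have start: "[Nt S] \<in> \<Lambda>"
    by (simp add: \<Lambda>_def)
  have tails: "\<beta> \<in> \<Lambda>" if "X # \<beta> \<in> \<Lambda>" for X \<beta>
    using that unfolding \<Lambda>_def by (auto dest: suffix_ConsD)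
  have rhs: "\<alpha> \<in> \<Lambda>" if "(A, \<alpha>) \<in> P" for A \<alpha>
    using that unfolding \<Lambda>_def by force
  have "cf_grammar (Q \<times> \<Lambda> \<times> Q) \<Sigma> (trans_prods P \<Lambda>) (p, [Nt S], q)"
    using fin assms start finite_states finite_output finite_trans_prods[OF fin] trans_prods_subset
    by (simp add: cf_grammar_def)
  moreover have complete: "yields (trans_prods P \<Lambda>) [Nt (p, [Nt S], q)] x"
    if "yields P [Nt S] w" "run \<Delta> p w x q" for w x
    by (rule trans_prods_complete[OF that start assms(2,3)]) (use tails rhs in blast)+
  have "{x. \<exists>w\<in>L. run \<Delta> p w x q} = grammar_language (trans_prods P \<Lambda>) (p, [Nt S], q)"
    unfolding L grammar_language_yields
    using trans_prods_sound[of P \<Lambda> p "[Nt S]" q] complete by blast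
  ultimately show ?thesis
    using context_free_languageI by metis
qed

end

section \<open>Preimages under sequential machines\<close>

text \<open>Only the output is collected; the state reached is
  \<open>foldl \<delta> q x\<close>.\<close>

fun out :: "('q \<Rightarrow> 's \<Rightarrow> 't list) \<Rightarrow> ('q \<Rightarrow> 's \<Rightarrow> 'q) \<Rightarrow> 'q \<Rightarrow> 's list \<Rightarrow> 't list" where
  "out o\<^sub>q \<delta> q [] = []"
| "out o\<^sub>q \<delta> q (a # x) = o\<^sub>q q a @ out o\<^sub>q \<delta> (\<delta> q a) x"

text \<open>
  The transducer runs the machine backwards: it guesses and emits the next input letter,
  stores the machine's output for it in a buffer, and consumes the buffer from its own input.
\<close>
theorem context_free_language_preimage:
  fixes o\<^sub>q :: "'q \<Rightarrow> 's \<Rightarrow> 't list" and \<delta> :: "'q \<Rightarrow> 's \<Rightarrow> 'q"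
  assumes L: "context_free_language \<Gamma> L" and "finite Q" "finite \<Sigma>"
    and \<delta>: "\<And>q a. q \<in> Q \<Longrightarrow> a \<in> \<Sigma> \<Longrightarrow> \<delta> q a \<in> Q"
    and "q0 \<in> Q" "qf \<in> Q"
  shows "context_free_language \<Sigma> {x \<in> lists \<Sigma>. out o\<^sub>q \<delta> q0 x \<in> L \<and> foldl \<delta> q0 x = qf}"
proof -
  \<comment> \<open>All unread remainders of machine outputs. The empty buffer is inserted
    separately since the union is empty when \<Sigma> is.\<close>
  define B where "B = insert [] (\<Union>q\<in>Q. \<Union>a\<in>\<Sigma>. set (suffixes (o\<^sub>q q a)))"
  \<comment> \<open>\<open>R\<close> drains the buffer letter by letter; \<open>E\<close> emits a
    letter and refills the buffer, but only once it is empty.\<close>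
  define R :: "(('q \<times> 't list) \<times> 't list \<times> 's list \<times> ('q \<times> 't list)) set"
    where "R = (\<lambda>(q, u). ((q, u), [hd u], [], (q, tl u))) ` (Q \<times> (B - {[]}))"
  define E :: "(('q \<times> 't list) \<times> 't list \<times> 's list \<times> ('q \<times> 't list)) set"
    where "E = (\<lambda>(q, a). ((q, []), [], [a], (\<delta> q a, o\<^sub>q q a))) ` (Q \<times> \<Sigma>)"
  have B: "finite B" "[] \<in> B" "\<And>t u. t # u \<in> B \<Longrightarrow> u \<in> B" "\<And>q a. q \<in> Q \<Longrightarrow> a \<in> \<Sigma> \<Longrightarrow> o\<^sub>q q a \<in> B"
    using assms(2,3) by (auto simp: B_def dest: suffix_ConsD)
  have R: "((q, t # u), [t], [], (q, u)) \<in> R" if "q \<in> Q" "t # u \<in> B" for q t u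
    using that unfolding R_def by force
  have E: "((q, []), [], [a], (\<delta> q a, o\<^sub>q q a)) \<in> E" if "q \<in> Q" "a \<in> \<Sigma>" for q a
    using that unfolding E_def by force
  interpret transducer "Q \<times> B" \<Sigma> "R \<union> E"
  proof
    show "finite (Q \<times> B)" "finite (R \<union> E)"
      using B(1) assms(2,3) by (auto simp: R_def E_def)
    show "p \<in> Q \<times> B \<and> length u \<le> 1 \<and> v \<in> lists \<Sigma> \<and> q \<in> Q \<times> B"
      if "(p, u, v, q) \<in> R \<union> E" for p u v q
      using that B(2-4) \<delta> by (auto simp: R_def E_def) (metis list.exhaust_sel)
  qed fact
  \<comment> \<open>Invariant: what is still to be read is the buffer followed by the machine's
    output on what is still to be written. An empty final buffer ensures that the last output is
    read completely.\<close>
  have sound: "w = snd p @ out o\<^sub>q \<delta> (fst p) x \<and> foldl \<delta> (fst p) x = fst r \<and> x \<in> lists \<Sigma>"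
    if "run (R \<union> E) p w x r" "snd r = []" for p w x r
    using that by induction (auto simp: R_def E_def)
  have drain: "run (R \<union> E) (q, u) (u @ w) x r" if "run (R \<union> E) (q, []) w x r" "q \<in> Q" "u \<in> B" for q u w x r
    using that(3)
  proof (induction u)
    case (Cons t u)
    then have "run (R \<union> E) (q, u) (u @ w) x r" using B(3) by blast
    then show ?case
      using run.step[of "(q, t # u)" "[t]" "[]" "(q, u)" "R \<union> E"] R[OF that(2) Cons.prems] by simp
  qed (use that in simp)
  have complete: "run (R \<union> E) (q, []) (out o\<^sub>q \<delta> q x) x (foldl \<delta> q x, [])"
    if "x \<in> lists \<Sigma>" "q \<in> Q" for x q
    using that
  proof (induction x arbitrary: q)
    case (Cons a x)
    then have "run (R \<union> E) (\<delta> q a, o\<^sub>q q a) (o\<^sub>q q a @ out o\<^sub>q \<delta> (\<delta> q a) x) x (foldl \<delta> (\<delta> q a) x, [])"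
      using \<delta> B(4) by (intro drain) auto
    then show ?case
      using run.step[of "(q, [])" "[]" "[a]" "(\<delta> q a, o\<^sub>q q a)" "R \<union> E"] E[of q a] Cons.hyps Cons.prems by simp
  qed (auto intro: run.stop)
  have "{x \<in> lists \<Sigma>. out o\<^sub>q \<delta> q0 x \<in> L \<and> foldl \<delta> q0 x = qf} =
      {x. \<exists>w\<in>L. run (R \<union> E) (q0, []) w x (qf, [])}"
  proof (intro Collect_cong iffI)
    fix x assume "x \<in> lists \<Sigma> \<and> out o\<^sub>q \<delta> q0 x \<in> L \<and> foldl \<delta> q0 x = qf"
    then show "\<exists>w\<in>L. run (R \<union> E) (q0, []) w x (qf, [])"
      using complete[of x q0] assms(5) by blast
  next
    fix x assume "\<exists>w\<in>L. run (R \<union> E) (q0, []) w x (qf, [])"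
    then show "x \<in> lists \<Sigma> \<and> out o\<^sub>q \<delta> q0 x \<in> L \<and> foldl \<delta> q0 x = qf"
      using sound[of "(q0, [])" _ x "(qf, [])"] by force
  qed
  then show ?thesis
    using context_free_image[OF L] assms(5,6) B(2) by simp
qed

section \<open>Presentations\<close>

lemma word_value_Nil [simp]: "word_value G \<psi> [] = \<one>\<^bsub>G\<^esub>"
  and word_value_Cons [simp]: "word_value G \<psi> (a # w) = \<psi> a \<otimes>\<^bsub>G\<^esub> word_value G \<psi> w"
  by (simp_all add: word_value_def)

lemma word_value_carrier_update [simp]: "word_value (G\<lparr>carrier := H\<rparr>) \<psi> = word_value G \<psi>"
  by (simp add: word_value_def fun_eq_iff)

context group
begin

lemma word_value_closed:
  "w \<in> lists \<Sigma> \<Longrightarrow> \<psi> \<in> \<Sigma> \<rightarrow> carrier G \<Longrightarrow> word_value G \<psi> w \<in> carrier G"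
  by (induction w) auto

lemma word_value_append:
  assumes "\<psi> \<in> \<Sigma> \<rightarrow> carrier G" "u \<in> lists \<Sigma>" "v \<in> lists \<Sigma>"
  shows "word_value G \<psi> (u @ v) = word_value G \<psi> u \<otimes> word_value G \<psi> v"
  using assms(2)
proof (induction u)
  case (Cons a u)
  then show ?case
    using assms word_value_closed[OF _ assms(1)] by (auto simp: m_assoc Pi_iff)
qed (use word_value_closed[OF assms(3,1)] in simp)

text \<open>Generators serve as their own letters, with \<open>id\<close> as the map; an injection
  of the finite set \<open>Y\<close> into \<open>nat\<close> then provides the required
  alphabet.\<close>

lemma semigroup_presentationI:
  assumes "finite Y" "Y \<subseteq> carrier G"
    and "\<And>g. g \<in> carrier G \<Longrightarrow> \<exists>w\<in>lists Y. word_value G id w = g"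
  obtains \<Sigma> :: "nat set" and \<psi> where "semigroup_presentation G \<Sigma> \<psi>"
proof -
  obtain f :: "'a \<Rightarrow> nat" where f: "inj_on f Y"
    using finite_imp_inj_to_nat_seg[OF assms(1)] by auto
  let ?g = "inv_into Y f"
  have g: "?g \<in> f ` Y \<rightarrow> carrier G"
    using f assms(2) by auto
  have "h \<in> word_value G ?g ` lists (f ` Y)" if h: "h \<in> carrier G" for h
  proof -
    obtain w where w: "w \<in> lists Y" "word_value G id w = h"
      using assms(3)[OF h] by blast
    have "map (?g \<circ> f) w = map id w"
      using w(1) f by (intro map_cong) auto
    with w(2) have "word_value G ?g (map f w) = h"
      by (simp add: word_value_def)
    moreover have "map f w \<in> lists (f ` Y)"
      using w(1) by auto
    ultimately show ?thesis by blast
  qed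
  then have "word_value G ?g ` lists (f ` Y) = carrier G"
    using word_value_closed[OF _ g] by (intro subset_antisym image_subsetI subsetI)
  with g have "semigroup_presentation G (f ` Y) ?g"
    using assms(1) by (simp add: semigroup_presentation_def)
  with that show thesis .
qed

text \<open>Inverses of the generators are added as letters, so every element of the generated group
  becomes the value of a word.\<close>

lemma finitely_generated_presentation:
  assumes "finitely_generated G"
  obtains \<Sigma> :: "nat set" and \<psi> where "semigroup_presentation G \<Sigma> \<psi>"
proof -
  obtain A where A: "finite A" "A \<subseteq> carrier G" "generate G A = carrier G"
    using assms by (auto simp: finitely_generated_def)
  let ?Y = "A \<union> m_inv G ` A"
  have Y: "id \<in> ?Y \<rightarrow> carrier G"
    using A(2) by auto
  have "\<exists>w\<in>lists ?Y. word_value G id w = g" if "g \<in> generate G A" for g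
    using that
  proof induction
    case one
    then show ?case by (auto intro: bexI[of _ "[]"])
  next
    case (incl h)
    then show ?case using A(2) by (auto intro!: bexI[of _ "[h]"])
  next
    case (inv h)
    then show ?case using A(2) by (auto intro!: bexI[of _ "[inv h]"])
  next
    case (eng g h)
    then obtain u v where "u \<in> lists ?Y" "word_value G id u = g" "v \<in> lists ?Y" "word_value G id v = h"
      by blast
    then show ?case
      using word_value_append[OF Y] by (intro bexI[of _ "u @ v"]) (simp_all del: id_apply)
  qed
  moreover have "finite ?Y" "?Y \<subseteq> carrier G"
    using A by auto
  ultimately obtain \<Sigma> :: "nat set" and \<psi> where "semigroup_presentation G \<Sigma> \<psi>"
    using semigroup_presentationI[of ?Y] A(3) by metis
  with that show thesis .
qed

section \<open>The coset machine\<close>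

lemma r_coset_rcosets:
  assumes "subgroup H G" "C \<in> rcosets H" "g \<in> carrier G"
  shows "C #> g \<in> rcosets H"
  using assms subgroup.subset[OF assms(1)]
  by (force simp: RCOSETS_def coset_mult_assoc)

text \<open>In use, \<open>s\<close> represents the coset reached after the first letter and cancels
  against its inverse.\<close>

lemma telescope:
  assumes "r \<in> carrier G" "a \<in> carrier G" "s \<in> carrier G" "b \<in> carrier G" "t \<in> carrier G"
  shows "(r \<otimes> a \<otimes> inv s) \<otimes> (s \<otimes> b \<otimes> inv t) = r \<otimes> (a \<otimes> b) \<otimes> inv t"
proof -
  have "inv s \<otimes> (s \<otimes> (b \<otimes> inv t)) = b \<otimes> inv t"
    using assms by (simp add: m_assoc[symmetric])
  then show ?thesis
    using assms by (simp add: m_assoc)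
qed

text \<open>
  Reading a word through the cosets of \<open>H\<close> rewrites it into Schreier generators of \<open>H\<close>;
  the product telescopes.
\<close>
lemma word_value_coset_machine:
  assumes H: "subgroup H G" and rep: "\<And>C. C \<in> rcosets H \<Longrightarrow> rep C \<in> C"
    and \<psi>: "\<psi> \<in> \<Sigma> \<rightarrow> carrier G" and \<phi>: "\<phi> \<in> \<Gamma> \<rightarrow> carrier G"
    and o\<^sub>q: "\<And>C a. C \<in> rcosets H \<Longrightarrow> a \<in> \<Sigma> \<Longrightarrow> o\<^sub>q C a \<in> lists \<Gamma> \<and>
      word_value G \<phi> (o\<^sub>q C a) = rep C \<otimes> \<psi> a \<otimes> inv (rep (C #> \<psi> a))"
    and "C \<in> rcosets H" "w \<in> lists \<Sigma>"
  shows "out o\<^sub>q (\<lambda>C a. C #> \<psi> a) C w \<in> lists \<Gamma> \<and>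
    foldl (\<lambda>C a. C #> \<psi> a) C w = C #> word_value G \<psi> w \<and>
    word_value G \<phi> (out o\<^sub>q (\<lambda>C a. C #> \<psi> a) C w) =
      rep C \<otimes> word_value G \<psi> w \<otimes> inv (rep (C #> word_value G \<psi> w))"
  using assms(7,6)
proof (induction w arbitrary: C)
  case Nil
  have "C \<subseteq> carrier G" using Nil subgroup.rcosets_carrier[OF H group_axioms] by blast
  with Nil rep[OF Nil] show ?case by (auto simp: coset_mult_one)
next
  case (Cons a w)
  have C: "C \<subseteq> carrier G" using Cons.prems subgroup.rcosets_carrier[OF H group_axioms] by blast
  have g: "\<psi> a \<in> carrier G" using Cons.hyps \<psi> by blast
  have v: "word_value G \<psi> w \<in> carrier G" using word_value_closed[OF Cons.hyps(2) \<psi>] .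
  have D: "C #> \<psi> a \<in> rcosets H"
    using r_coset_rcosets[OF H Cons.prems g] .
  have assoc: "C #> \<psi> a #> word_value G \<psi> w = C #> (\<psi> a \<otimes> word_value G \<psi> w)"
    using C g v by (simp add: coset_mult_assoc)
  have E: "C #> (\<psi> a \<otimes> word_value G \<psi> w) \<in> rcosets H"
    using r_coset_rcosets[OF H Cons.prems m_closed[OF g v]] .
  have rep_closed: "rep B \<in> carrier G" if "B \<in> rcosets H" for B
    using rep[OF that] subgroup.rcosets_carrier[OF H group_axioms that] by (rule rev_subsetD)
  note reps = rep_closed[OF Cons.prems] rep_closed[OF D] rep_closed[OF E]
  note o\<^sub>q = o\<^sub>q[OF Cons.prems Cons.hyps(1)] and IH = Cons.IH[OF D, unfolded assoc]
  have "word_value G \<phi> (out o\<^sub>q (\<lambda>C a. C #> \<psi> a) C (a # w)) =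
      word_value G \<phi> (o\<^sub>q C a) \<otimes> word_value G \<phi> (out o\<^sub>q (\<lambda>C a. C #> \<psi> a) (C #> \<psi> a) w)"
    using word_value_append[OF \<phi>] o\<^sub>q IH by simp
  also have "\<dots> = rep C \<otimes> (\<psi> a \<otimes> word_value G \<psi> w) \<otimes>
      inv (rep (C #> (\<psi> a \<otimes> word_value G \<psi> w)))"
    using o\<^sub>q IH telescope[OF reps(1) g reps(2) v reps(3)] by simp
  finally show ?case
    using o\<^sub>q IH by simp
qed

text \<open>The normalisation \<open>rep H = \<one>\<close> makes rewriting preserve the value of a
  word that leads from \<open>H\<close> back to \<open>H\<close>.\<close>

lemma obtain_coset_reps:
  assumes "subgroup H G"
  obtains rep where "\<And>C. C \<in> rcosets H \<Longrightarrow> rep C \<in> C" "rep H = \<one>"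
proof -
  define rep where "rep C = (if C = H then \<one> else SOME x. x \<in> C)" for C
  have "rep C \<in> C" if "C \<in> rcosets H" for C
    using that assms subgroup.rcosets_non_empty[OF assms that] subgroup.one_closed[OF assms]
    by (auto simp: rep_def some_in_eq)
  then show thesis
    using that[of rep] by (simp add: rep_def)
qed

text \<open>Both \<open>rep C \<otimes> g\<close> and \<open>rep (C #> g)\<close> lie in the right
  coset \<open>C #> g\<close>, so their quotient lies in \<open>H\<close>. With
  \<open>C = H #> c\<close> it is \<open>k \<otimes> inv h\<close>, where \<open>k\<close> and
  \<open>h\<close> are the \<open>H\<close>-parts of the two representatives.\<close>

lemma schreier_generator_closed:
  assumes H: "subgroup H G" and rep: "\<And>C. C \<in> rcosets H \<Longrightarrow> rep C \<in> C"
    and "C \<in> rcosets H" "g \<in> carrier G"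
  shows "rep C \<otimes> g \<otimes> inv (rep (C #> g)) \<in> H"
proof -
  have Hc: "H \<subseteq> carrier G" using subgroup.subset[OF H] .
  obtain c where c: "c \<in> carrier G" "C = H #> c"
    using assms(3) by (auto simp: RCOSETS_def)
  then have D: "C #> g = H #> (c \<otimes> g)"
    using assms(4) Hc by (simp add: coset_mult_assoc)
  with rep[OF r_coset_rcosets[OF H assms(3,4)]] have "rep (C #> g) \<in> H #> (c \<otimes> g)" by simp
  then obtain h where h: "h \<in> H" "rep (C #> g) = h \<otimes> (c \<otimes> g)" by (auto simp: r_coset_def)
  obtain k where k: "k \<in> H" "rep C = k \<otimes> c"
    using rep[OF assms(3)] c by (auto simp: r_coset_def)
  have hk: "h \<in> carrier G" "k \<in> carrier G" using h k Hc by auto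
  have "rep C \<otimes> g \<otimes> inv (rep (C #> g)) = k \<otimes> (c \<otimes> g) \<otimes> (inv (c \<otimes> g) \<otimes> inv h)"
    using c hk assms(4) unfolding h(2) k(2) by (simp add: m_assoc inv_mult_group)
  also have "\<dots> = k \<otimes> inv h"
    using c hk assms(4) inv_solve_right by (metis inv_closed m_assoc m_closed r_inv r_one)
  finally show ?thesis
    using h k H by (simp add: subgroup.m_closed subgroup.m_inv_closed)
qed

text \<open>Schreier's lemma for monoid generation: a word for an element of \<open>H\<close> leads
  from the coset \<open>H\<close> back to \<open>H\<close>, and the machine rewrites it as a product
  of the finitely many Schreier elements, with no inverses of them.\<close>

lemma finite_index_presentation:
  assumes H: "subgroup H G" and fin: "finite (rcosets H)" and pres: "semigroup_presentation G \<Sigma> \<psi>"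
  obtains \<Gamma> :: "nat set" and \<phi> where "semigroup_presentation (G\<lparr>carrier := H\<rparr>) \<Gamma> \<phi>"
proof -
  interpret H: group "G\<lparr>carrier := H\<rparr>"
    using H by (rule subgroup.subgroup_is_group) (rule group_axioms)
  obtain rep where rep: "\<And>C. C \<in> rcosets H \<Longrightarrow> rep C \<in> C" "rep H = \<one>"
    using obtain_coset_reps[OF H] by blast
  have \<psi>: "finite \<Sigma>" "\<psi> \<in> \<Sigma> \<rightarrow> carrier G" "word_value G \<psi> ` lists \<Sigma> = carrier G"
    using pres by (auto simp: semigroup_presentation_def)
  define y where "y C a = rep C \<otimes> \<psi> a \<otimes> inv (rep (C #> \<psi> a))" for C a
  define Y where "Y = (\<lambda>(C, a). y C a) ` ((rcosets H) \<times> \<Sigma>)"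
  have "Y \<subseteq> H"
    using schreier_generator_closed[OF H rep(1)] \<psi>(2) by (auto simp: Y_def y_def)
  moreover have "finite Y"
    using fin \<psi>(1) by (simp add: Y_def)
  moreover have "\<exists>w\<in>lists Y. word_value G id w = h" if "h \<in> H" for h
  proof -
    have Hc: "H \<subseteq> carrier G" using subgroup.subset[OF H] .
    with that \<psi>(3) have "h \<in> word_value G \<psi> ` lists \<Sigma>" by auto
    then obtain w where w: "w \<in> lists \<Sigma>" "word_value G \<psi> w = h" by (elim imageE) simp
    have HH: "H \<in> rcosets H" using H group_axioms by (rule subgroup.subgroup_in_rcosets)
    have y: "[y C a] \<in> lists Y \<and>
        word_value G id [y C a] = rep C \<otimes> \<psi> a \<otimes> inv (rep (C #> \<psi> a))"
      if "C \<in> rcosets H" "a \<in> \<Sigma>" for C a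
    proof -
      have "y C a \<in> Y" using that by (force simp: Y_def)
      moreover from this have "y C a \<in> carrier G" using \<open>Y \<subseteq> H\<close> Hc by blast
      ultimately show ?thesis by (simp add: y_def[symmetric])
    qed
    have "id \<in> Y \<rightarrow> carrier G" using \<open>Y \<subseteq> H\<close> Hc by auto
    note machine = word_value_coset_machine[OF H rep(1) \<psi>(2) this y HH w(1)]
    \<comment> \<open>The representatives at both ends are thus \<open>\<one>\<close>, so the
      telescoped product is \<open>h\<close> itself.\<close>
    have "h \<in> carrier G" "H #> h = H"
      using that Hc coset_join2[OF _ H] by auto
    with machine w(2) rep(2)
    have "word_value G id (out (\<lambda>C a. [y C a]) (\<lambda>C a. C #> \<psi> a) H w) = h"
      by (simp del: id_apply)
    with machine show ?thesis by blast
  qed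
  ultimately obtain \<Gamma> :: "nat set" and \<phi> where
      "semigroup_presentation (G\<lparr>carrier := H\<rparr>) \<Gamma> \<phi>"
    using H.semigroup_presentationI[of Y] by (simp del: id_apply) metis
  with that show thesis .
qed

section \<open>The two directions of the equivalence\<close>

lemma choose_words:
  assumes "\<And>x. x \<in> X \<Longrightarrow> f x \<in> word_value G \<psi> ` lists \<Sigma>"
  obtains u where "\<And>x. x \<in> X \<Longrightarrow> u x \<in> lists \<Sigma> \<and> word_value G \<psi> (u x) = f x"
proof -
  have "\<forall>x\<in>X. \<exists>w. w \<in> lists \<Sigma> \<and> word_value G \<psi> w = f x"
    using assms by (metis imageE)
  from bchoice[OF this] that show thesis by blast
qed

text \<open>Finite index supplies a presentation of \<open>H\<close>. Spelling its letters as words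
  over \<Sigma> of the same value pulls the language of \<open>(G, K)\<close> back to that of
  \<open>(H, K)\<close>.\<close>

lemma context_free_pair_subgroup:
  assumes H: "subgroup H G" and fin: "finite (rcosets H)" and cf: "context_free_pair G K"
  shows "context_free_pair (G\<lparr>carrier := H\<rparr>) K"
proof -
  obtain \<Sigma> :: "nat set" and \<psi> where pres: "semigroup_presentation G \<Sigma> \<psi>"
    and L: "context_free_language \<Sigma> (pair_language G K \<Sigma> \<psi>)"
    using cf unfolding context_free_pair_def by blast
  obtain \<Gamma> :: "nat set" and \<phi> where \<phi>: "semigroup_presentation (G\<lparr>carrier := H\<rparr>) \<Gamma> \<phi>"
    using finite_index_presentation[OF H fin pres] by blast
  have "\<phi> a \<in> word_value G \<psi> ` lists \<Sigma>" if "a \<in> \<Gamma>" for a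
  proof -
    have "\<phi> a \<in> H"
      using that \<phi> unfolding semigroup_presentation_def by auto
    then show ?thesis
      using pres subgroup.subset[OF H] unfolding semigroup_presentation_def by blast
  qed
  then obtain u where u: "\<And>a. a \<in> \<Gamma> \<Longrightarrow> u a \<in> lists \<Sigma> \<and> word_value G \<psi> (u a) = \<phi> a"
    using choose_words by metis
  \<comment> \<open>A machine with the single state \<open>()\<close> is a monoid homomorphism; its
    condition on the final state always holds.\<close>
  let ?out = "out (\<lambda>_. u) (\<lambda>_ _. ()) ()"
  have \<psi>: "\<psi> \<in> \<Sigma> \<rightarrow> carrier G"
    using pres by (simp add: semigroup_presentation_def)
  have "?out w \<in> lists \<Sigma> \<and> word_value G \<psi> (?out w) = word_value G \<phi> w" if "w \<in> lists \<Gamma>" for w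
    using that
  proof (induction w)
    case (Cons a w)
    then show ?case using u[of a] by (simp add: word_value_append[OF \<psi>])
  qed simp
  then have "w \<in> pair_language (G\<lparr>carrier := H\<rparr>) K \<Gamma> \<phi> \<longleftrightarrow>
      w \<in> lists \<Gamma> \<and> ?out w \<in> pair_language G K \<Sigma> \<psi> \<and> foldl (\<lambda>_ _. ()) () w = ()" for w
    by (cases "w \<in> lists \<Gamma>") (simp_all add: pair_language_def del: in_lists_conv_set)
  then have "pair_language (G\<lparr>carrier := H\<rparr>) K \<Gamma> \<phi> =
      {w \<in> lists \<Gamma>. ?out w \<in> pair_language G K \<Sigma> \<psi> \<and> foldl (\<lambda>_ _. ()) () w = ()}"
    by blast
  moreover have "context_free_language \<Gamma> \<dots>"
    using \<phi> by (intro context_free_language_preimage[OF L, of UNIV])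
      (auto simp: semigroup_presentation_def)
  ultimately show ?thesis
    using \<phi> unfolding context_free_pair_def by metis
qed

text \<open>Since \<open>K \<subseteq> H\<close>, a word with value in \<open>K\<close> must return
  to the coset \<open>H\<close>, and on returning words the machine preserves values. So the
  language of \<open>(G, K)\<close> is a preimage of that of \<open>(H, K)\<close>.\<close>

lemma context_free_pair_overgroup:
  assumes fg: "finitely_generated G" and H: "subgroup H G" and fin: "finite (rcosets H)"
    and K: "K \<subseteq> H" and cf: "context_free_pair (G\<lparr>carrier := H\<rparr>) K"
  shows "context_free_pair G K"
proof -
  obtain \<Gamma> :: "nat set" and \<phi> where \<phi>: "semigroup_presentation (G\<lparr>carrier := H\<rparr>) \<Gamma> \<phi>"
    and L: "context_free_language \<Gamma> (pair_language (G\<lparr>carrier := H\<rparr>) K \<Gamma> \<phi>)"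
    using cf unfolding context_free_pair_def by blast
  obtain \<Sigma> :: "nat set" and \<psi> where pres: "semigroup_presentation G \<Sigma> \<psi>"
    using finitely_generated_presentation[OF fg] by blast
  have \<psi>: "\<psi> \<in> \<Sigma> \<rightarrow> carrier G"
    using pres by (simp add: semigroup_presentation_def)
  have Hc: "H \<subseteq> carrier G" using subgroup.subset[OF H] .
  have \<phi>G: "\<phi> \<in> \<Gamma> \<rightarrow> carrier G"
    using \<phi> Hc unfolding semigroup_presentation_def by fastforce
  obtain rep where rep: "\<And>C. C \<in> rcosets H \<Longrightarrow> rep C \<in> C" "rep H = \<one>"
    using obtain_coset_reps[OF H] by blast
  let ?\<delta> = "\<lambda>C a. C #> \<psi> a"
  \<comment> \<open>State and letter are paired because the chosen word depends on both.\<close>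
  have "rep (fst x) \<otimes> \<psi> (snd x) \<otimes> inv (rep (fst x #> \<psi> (snd x))) \<in> word_value G \<phi> ` lists \<Gamma>"
    if "x \<in> (rcosets H) \<times> \<Sigma>" for x
  proof -
    have "fst x \<in> rcosets H" "\<psi> (snd x) \<in> carrier G"
      using that \<psi> by auto
    from schreier_generator_closed[OF H rep(1) this] \<phi> show ?thesis
      by (simp add: semigroup_presentation_def)
  qed
  then obtain u where u: "\<And>x. x \<in> (rcosets H) \<times> \<Sigma> \<Longrightarrow> u x \<in> lists \<Gamma> \<and>
      word_value G \<phi> (u x) = rep (fst x) \<otimes> \<psi> (snd x) \<otimes> inv (rep (fst x #> \<psi> (snd x)))"
    using choose_words[of "(rcosets H) \<times> \<Sigma>"
        "\<lambda>x. rep (fst x) \<otimes> \<psi> (snd x) \<otimes> inv (rep (fst x #> \<psi> (snd x)))"] by metis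
  let ?out = "out (\<lambda>C a. u (C, a)) ?\<delta> H"
  have HH: "H \<in> rcosets H" using H group_axioms by (rule subgroup.subgroup_in_rcosets)
  have "word_value G \<psi> w \<in> K \<longleftrightarrow>
      ?out w \<in> lists \<Gamma> \<and> word_value G \<phi> (?out w) \<in> K \<and> foldl ?\<delta> H w = H"
    if w: "w \<in> lists \<Sigma>" for w
  proof -
    have g: "word_value G \<psi> w \<in> carrier G" using word_value_closed[OF w \<psi>] .
    have machine: "?out w \<in> lists \<Gamma> \<and> foldl ?\<delta> H w = H #> word_value G \<psi> w \<and>
      word_value G \<phi> (?out w) =
        rep H \<otimes> word_value G \<psi> w \<otimes> inv (rep (H #> word_value G \<psi> w))"
      using u by (intro word_value_coset_machine[OF H rep(1) \<psi> \<phi>G _ HH w]) auto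
    \<comment> \<open>Acceptance in state \<open>H\<close> tests membership in \<open>H\<close>; in
      that case both representatives in \<open>machine\<close> are \<open>\<one>\<close>.\<close>
    have "word_value G \<psi> w \<in> H \<longleftrightarrow> H #> word_value G \<psi> w = H"
      using coset_join1[OF _ g H] coset_join2[OF g H] Hc by blast
    with machine g K rep(2) show ?thesis by auto
  qed
  then have "pair_language G K \<Sigma> \<psi> =
      {w \<in> lists \<Sigma>. ?out w \<in> pair_language (G\<lparr>carrier := H\<rparr>) K \<Gamma> \<phi> \<and> foldl ?\<delta> H w = H}"
    unfolding pair_language_def by (auto simp del: in_lists_conv_set)
  moreover have "context_free_language \<Sigma> \<dots>"
  proof (rule context_free_language_preimage[OF L fin _ _ HH HH])
    show "C #> \<psi> a \<in> rcosets H" if "C \<in> rcosets H" "a \<in> \<Sigma>" for C a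
      using that \<psi> by (intro r_coset_rcosets[OF H]) auto
  qed (use pres in \<open>simp add: semigroup_presentation_def\<close>)
  ultimately show ?thesis
    using pres unfolding context_free_pair_def by metis
qed

end

theorem proposition3p3:
  fixes G :: "('a, 'm) monoid_scheme" and H K :: "'a set"
  assumes "group G"
    and "finitely_generated G"
    and "subgroup H G"
    and "finite (rcosets\<^bsub>G\<^esub> H)"
    and "subgroup K (G\<lparr>carrier := H\<rparr>)"
  shows "context_free_pair G K \<longleftrightarrow> context_free_pair (G\<lparr>carrier := H\<rparr>) K"
proof -
  have "K \<subseteq> H"
    using subgroup.subset[OF assms(5)] by simp
  then show ?thesis
    using assms group.context_free_pair_subgroup group.context_free_pair_overgroup by blast
qed

end
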